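(* Let $d^\bullet=(U^i,d_i:U^i\to U^{i+1})_{i\in\mathbb{Z}}$ be a complex in the category of Hilbert spaces and continuous linear maps. If the images of the Laplace operators $\Delta_i=d_i^*d_i+d_{i-1}d_{i-1}^*$, $i\in\mathbb{Z}$, are closed, then the Hodge theory holds for $d^\bullet$.
   Context: Hilbert spaces are not assumed to be separable. Complex means $d_{i+1}d_i=0$ for all $i\in\mathbb{Z}$; $d_i^*:U^{i+1}\to U^i$ is the Hilbert space adjoint of $d_i$. The Hodge theory holds for $d^\bullet$ if for each $i\in\mathbb{Z}$, $U^i=\mathrm{Im}\,d_{i-1}\oplus\mathrm{Im}\,d_i^*\oplus\mathrm{Ker}\,\Delta_i$, where $\oplus$ denotes orthogonal direct sum. *)

theory Defs
  imports "HOL-Analysis.Analysis" "HOL-Algebra.Module" "HOL-Algebra.AbelCoset"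
begin

text \<open>
  The spaces of a complex are pairwise unrelated Hilbert spaces indexed by the integers, so a
  Hilbert space is rendered as a structure with an explicit carrier, on top of the modules of
  HOL-Algebra. The parameter \<open>K\<close> is the scalar field, either the reals or the complex numbers;
  in both cases scalars are represented as elements of type \<^typ>\<open>complex\<close>.
\<close>

definition scalar_field :: "complex set \<Rightarrow> complex ring"
  where "scalar_field K = \<lparr>carrier = K, mult = (*), one = 1, zero = 0, add = (+)\<rparr>"

text \<open>
  The fields \<^const>\<open>mult\<close> and \<^const>\<open>one\<close> of the underlying record are not used: the locale
  \<open>module\<close> of HOL-Algebra imposes no condition on them.
\<close>

record 'a ip_space = "(complex, 'a) module" +
  ip :: "'a \<Rightarrow> 'a \<Rightarrow> complex"

definition ip_norm :: "('a, 'm) ip_space_scheme \<Rightarrow> 'a \<Rightarrow> real"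
  where "ip_norm H x = sqrt (Re (ip H x x))"

text \<open>
  The value \<open>0\<close> outside the carrier is needed because the locale \<^locale>\<open>Metric_space\<close> requires
  nonnegativity and symmetry of the distance on the whole type.
\<close>

definition ip_dist :: "('a, 'm) ip_space_scheme \<Rightarrow> 'a \<Rightarrow> 'a \<Rightarrow> real"
  where "ip_dist H x y =
    (if x \<in> carrier H \<and> y \<in> carrier H then ip_norm H (x \<ominus>\<^bsub>H\<^esub> y) else 0)"

abbreviation ip_topology :: "('a, 'm) ip_space_scheme \<Rightarrow> 'a topology"
  where "ip_topology H \<equiv> Metric_space.mtopology (carrier H) (ip_dist H)"

locale inner_product_space = Module.module "scalar_field K" H
  for K :: "complex set" and H :: "('a, 'm) ip_space_scheme" (structure) +
  assumes real_or_complex: "K = \<real> \<or> K = UNIV"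
    and ip_closed: "\<lbrakk>x \<in> carrier H; y \<in> carrier H\<rbrakk> \<Longrightarrow> ip H x y \<in> K"
    and ip_add_left:
      "\<lbrakk>x \<in> carrier H; y \<in> carrier H; z \<in> carrier H\<rbrakk> \<Longrightarrow> ip H (x \<oplus> y) z = ip H x z + ip H y z"
    and ip_smult_left:
      "\<lbrakk>c \<in> K; x \<in> carrier H; y \<in> carrier H\<rbrakk> \<Longrightarrow> ip H (c \<odot>\<^bsub>H\<^esub> x) y = c * ip H x y"
    and ip_commute: "\<lbrakk>x \<in> carrier H; y \<in> carrier H\<rbrakk> \<Longrightarrow> ip H y x = cnj (ip H x y)"
    and ip_pos: "\<lbrakk>x \<in> carrier H; x \<noteq> \<zero>\<rbrakk> \<Longrightarrow> Re (ip H x x) > 0"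

locale hilbert_space = inner_product_space +
  assumes complete: "Metric_space.mcomplete (carrier H) (ip_dist H)"

definition continuous_linear_map ::
    "complex set \<Rightarrow> ('a, 'm) ip_space_scheme \<Rightarrow> ('b, 'n) ip_space_scheme \<Rightarrow> ('a \<Rightarrow> 'b) \<Rightarrow> bool"
  where "continuous_linear_map K G H T \<longleftrightarrow>
    T \<in> hom (add_monoid G) (add_monoid H) \<and>
    (\<forall>c\<in>K. \<forall>x\<in>carrier G. T (c \<odot>\<^bsub>G\<^esub> x) = c \<odot>\<^bsub>H\<^esub> T x) \<and>
    continuous_map (ip_topology G) (ip_topology H) T"

text \<open>
  For continuous linear maps between Hilbert spaces the described element exists and is unique by
  the Riesz representation theorem.
\<close>

definition adjoint_map ::
    "('a, 'm) ip_space_scheme \<Rightarrow> ('b, 'n) ip_space_scheme \<Rightarrow> ('a \<Rightarrow> 'b) \<Rightarrow> 'b \<Rightarrow> 'a"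
  where "adjoint_map G H T y =
    (THE x. x \<in> carrier G \<and> (\<forall>z\<in>carrier G. ip H (T z) y = ip G z x))"

locale hilbert_complex =
  fixes K :: "complex set" and U :: "int \<Rightarrow> 'a ip_space" and d :: "int \<Rightarrow> 'a \<Rightarrow> 'a"
  assumes hilbert: "hilbert_space K (U i)"
    and differential: "continuous_linear_map K (U i) (U (i + 1)) (d i)"
    and differential_square: "x \<in> carrier (U i) \<Longrightarrow> d (i + 1) (d i x) = \<zero>\<^bsub>U (i + 2)\<^esub>"

definition diff_adjoint :: "(int \<Rightarrow> 'a ip_space) \<Rightarrow> (int \<Rightarrow> 'a \<Rightarrow> 'a) \<Rightarrow> int \<Rightarrow> 'a \<Rightarrow> 'a"
  where "diff_adjoint U d i = adjoint_map (U i) (U (i + 1)) (d i)"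

definition laplace :: "(int \<Rightarrow> 'a ip_space) \<Rightarrow> (int \<Rightarrow> 'a \<Rightarrow> 'a) \<Rightarrow> int \<Rightarrow> 'a \<Rightarrow> 'a"
  where "laplace U d i x =
    diff_adjoint U d i (d i x) \<oplus>\<^bsub>U i\<^esub> d (i - 1) (diff_adjoint U d (i - 1) x)"

definition orthogonal_subsets :: "('a, 'm) ip_space_scheme \<Rightarrow> 'a set \<Rightarrow> 'a set \<Rightarrow> bool"
  where "orthogonal_subsets H A B \<longleftrightarrow> (\<forall>a\<in>A. \<forall>b\<in>B. ip H a b = 0)"

text \<open>Directness of the sum follows from the pairwise orthogonality of the summands.\<close>

definition orthogonal_direct_sum ::
    "complex set \<Rightarrow> ('a, 'm) ip_space_scheme \<Rightarrow> 'a set \<Rightarrow> 'a set \<Rightarrow> 'a set \<Rightarrow> bool"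
  where "orthogonal_direct_sum K H A B C \<longleftrightarrow>
    submodule A (scalar_field K) H \<and> submodule B (scalar_field K) H \<and>
    submodule C (scalar_field K) H \<and>
    orthogonal_subsets H A B \<and> orthogonal_subsets H A C \<and> orthogonal_subsets H B C \<and>
    carrier H = A <+>\<^bsub>H\<^esub> B <+>\<^bsub>H\<^esub> C"

definition hodge_theory_holds :: "complex set \<Rightarrow> (int \<Rightarrow> 'a ip_space) \<Rightarrow> (int \<Rightarrow> 'a \<Rightarrow> 'a) \<Rightarrow> bool"
  where "hodge_theory_holds K U d \<longleftrightarrow>
    (\<forall>i. orthogonal_direct_sum K (U i)
      (d (i - 1) ` carrier (U (i - 1)))
      (diff_adjoint U d i ` carrier (U (i + 1)))
      (a_kernel (U i) (U i) (laplace U d i)))"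

end

theory Submission
  imports Defs
begin

text \<open>
  The Laplacian \<open>\<Delta> = d* d + d d*\<close> is symmetric, so the orthogonal complement of its image is its
  kernel: if \<open>k\<close> is orthogonal to the image, then the inner product of \<open>\<Delta> k\<close> with itself equals
  that of \<open>k\<close> with \<open>\<Delta> (\<Delta> k)\<close>, which is \<open>0\<close>. Since the image is closed, the projection theorem
  writes every element as \<open>\<Delta> u + k\<close> with \<open>\<Delta> k = 0\<close>, and \<open>\<Delta> u\<close> is the sum of \<open>d (d* u)\<close> and
  \<open>d* (d u)\<close>. The summands are orthogonal because \<open>d d = 0\<close> and because the kernel of \<open>\<Delta>\<close> is the
  intersection of the kernels of \<open>d\<close> and \<open>d*\<close>.
\<close>

section \<open>Scalars and the elementary rules of the inner product\<close>

context inner_product_space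
begin

lemma carrier_scalar_field [simp]: "carrier (scalar_field K) = K"
  by (simp add: scalar_field_def)

lemma
  shows scalar_cnj [simp]: "a \<in> K \<Longrightarrow> cnj a \<in> K"
    and scalar_of_real [simp]: "complex_of_real r \<in> K"
    and scalar_divide: "\<lbrakk>a \<in> K; b \<in> K\<rbrakk> \<Longrightarrow> a / b \<in> K"
  using real_or_complex by (auto elim!: Reals_cases)

lemma scalar_minus_one [simp]: "- 1 \<in> K"
  using scalar_of_real[of "-1"] by simp

lemma smult_carrier [simp]: "\<lbrakk>c \<in> K; x \<in> carrier H\<rbrakk> \<Longrightarrow> c \<odot>\<^bsub>H\<^esub> x \<in> carrier H"
  using smult_closed by simp

lemma a_minus_carrier [simp]: "\<lbrakk>x \<in> carrier H; y \<in> carrier H\<rbrakk> \<Longrightarrow> x \<ominus> y \<in> carrier H"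
  by (rule M.minus_closed)

lemma add_minus_cancel: "\<lbrakk>x \<in> carrier H; y \<in> carrier H\<rbrakk> \<Longrightarrow> y \<oplus> (x \<ominus> y) = x"
  by (metis M.a_assoc M.a_comm M.a_inv_closed M.l_neg M.r_zero a_minus_carrier a_minus_def)

lemma ip_zero_left [simp]: "y \<in> carrier H \<Longrightarrow> ip H \<zero> y = 0"
  using ip_add_left[of \<zero> \<zero> y] by simp

lemma ip_zero_right [simp]: "x \<in> carrier H \<Longrightarrow> ip H x \<zero> = 0"
  using ip_commute[of \<zero> x] by simp

lemma ip_neg_left: "\<lbrakk>x \<in> carrier H; y \<in> carrier H\<rbrakk> \<Longrightarrow> ip H (\<ominus> x) y = - ip H x y"
  using ip_add_left[of x "\<ominus> x" y] by (simp add: M.r_neg add_eq_0_iff)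

lemma ip_neg_right: "\<lbrakk>x \<in> carrier H; y \<in> carrier H\<rbrakk> \<Longrightarrow> ip H x (\<ominus> y) = - ip H x y"
  using ip_commute[of "\<ominus> y" x] ip_commute[of y x] by (simp add: ip_neg_left)

lemma ip_diff_left:
  "\<lbrakk>x \<in> carrier H; y \<in> carrier H; z \<in> carrier H\<rbrakk> \<Longrightarrow> ip H (x \<ominus> y) z = ip H x z - ip H y z"
  by (simp add: a_minus_def ip_add_left ip_neg_left)

lemma ip_add_right:
  "\<lbrakk>x \<in> carrier H; y \<in> carrier H; z \<in> carrier H\<rbrakk> \<Longrightarrow> ip H x (y \<oplus> z) = ip H x y + ip H x z"
  using ip_commute[of "y \<oplus> z" x] ip_commute[of y x] ip_commute[of z x] by (simp add: ip_add_left)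

lemma ip_diff_right:
  "\<lbrakk>x \<in> carrier H; y \<in> carrier H; z \<in> carrier H\<rbrakk> \<Longrightarrow> ip H x (y \<ominus> z) = ip H x y - ip H x z"
  using ip_commute[of "y \<ominus> z" x] ip_commute[of y x] ip_commute[of z x] by (simp add: ip_diff_left)

lemma ip_smult_right:
  "\<lbrakk>c \<in> K; x \<in> carrier H; y \<in> carrier H\<rbrakk> \<Longrightarrow> ip H x (c \<odot>\<^bsub>H\<^esub> y) = cnj c * ip H x y"
  using ip_commute[of "c \<odot>\<^bsub>H\<^esub> y" x] ip_commute[of y x] by (simp add: ip_smult_left)

lemmas ip_simps = ip_add_left ip_add_right ip_diff_left ip_diff_right ip_smult_left ip_smult_right

section \<open>Norm, nondegeneracy, Cauchy-Schwarz and the triangle inequality\<close>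

lemma ip_self_nonneg: "x \<in> carrier H \<Longrightarrow> 0 \<le> Re (ip H x x)"
  using ip_pos[of x] by (cases "x = \<zero>") auto

text \<open>Conjugate symmetry makes \<open>ip H x x\<close> real, and its nonnegativity lets
  squaring undo the root in \<open>ip_norm\<close>.\<close>

lemma ip_self: "x \<in> carrier H \<Longrightarrow> ip H x x = complex_of_real ((ip_norm H x)\<^sup>2)"
  using ip_commute[of x x] ip_self_nonneg[of x]
  by (simp add: ip_norm_def complex_eq_iff)

lemma ip_norm_nonneg [simp]: "x \<in> carrier H \<Longrightarrow> 0 \<le> ip_norm H x"
  by (simp add: ip_norm_def ip_self_nonneg)

lemma ip_norm_eq_0 [simp]: "x \<in> carrier H \<Longrightarrow> ip_norm H x = 0 \<longleftrightarrow> x = \<zero>"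
  using ip_pos[of x] by (cases "x = \<zero>") (auto simp: ip_norm_def)

lemma ip_self_eq_0 [simp]: "x \<in> carrier H \<Longrightarrow> ip H x x = 0 \<longleftrightarrow> x = \<zero>"
  by (simp add: ip_self)

lemma eq_if_minus_eq_zero: "\<lbrakk>x \<in> carrier H; y \<in> carrier H; x \<ominus> y = \<zero>\<rbrakk> \<Longrightarrow> x = y"
  using add_minus_cancel[of x y] by simp

text \<open>Nondegeneracy: the difference of \<open>x\<close> and \<open>y\<close> is orthogonal to
  everything, hence to itself. This reduces identities between vectors to identities between
  scalars, and is how linearity of the adjoint and of the Laplacian is obtained later.\<close>

lemma ip_eqI:
  assumes "x \<in> carrier H" "y \<in> carrier H" "\<And>z. z \<in> carrier H \<Longrightarrow> ip H z x = ip H z y"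
  shows "x = y"
proof -
  have "ip H (x \<ominus> y) (x \<ominus> y) = 0"
    using assms by (simp add: ip_diff_right)
  then show ?thesis
    using assms eq_if_minus_eq_zero by simp
qed

text \<open>Pythagoras for the part of \<open>x\<close> orthogonal to \<open>y\<close>.
  Nonnegativity of the left side is Cauchy-Schwarz; the exact amount subtracted on the right is what
  makes a closest point orthogonal in the projection theorem.\<close>

lemma ip_norm_minus_projection:
  assumes "x \<in> carrier H" "y \<in> carrier H" "y \<noteq> \<zero>"
  shows "(ip_norm H (x \<ominus> (ip H x y / ip H y y) \<odot>\<^bsub>H\<^esub> y))\<^sup>2
    = (ip_norm H x)\<^sup>2 - (cmod (ip H x y))\<^sup>2 / (ip_norm H y)\<^sup>2"
proof -
  define c where "c = ip H x y / ip H y y"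
  have c: "c \<in> K"
    unfolding c_def using assms by (intro scalar_divide ip_closed)
  have ne: "ip_norm H y \<noteq> 0"
    using assms by simp
  have "ip H (x \<ominus> c \<odot>\<^bsub>H\<^esub> y) (x \<ominus> c \<odot>\<^bsub>H\<^esub> y)
      = ip H x x - cnj c * ip H x y - c * cnj (ip H x y) + c * cnj c * ip H y y"
    using assms c ip_commute[of x y] by (simp add: ip_simps algebra_simps)
  \<comment> \<open>Since \<open>ip H y y\<close> is real, the last three terms are all multiples of
    the same quotient, with coefficients -1, -1 and +1.\<close>
  also have "\<dots> = ip H x x - ip H x y * cnj (ip H x y) / ip H y y"
    using assms ne by (simp add: c_def ip_self[of y] power2_eq_square field_simps)
  also have "\<dots> = complex_of_real ((ip_norm H x)\<^sup>2 - (cmod (ip H x y))\<^sup>2 / (ip_norm H y)\<^sup>2)"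
    using assms by (simp only: ip_self[of x] ip_self[of y] complex_norm_square[symmetric]
        of_real_diff of_real_divide)
  finally have "complex_of_real ((ip_norm H (x \<ominus> c \<odot>\<^bsub>H\<^esub> y))\<^sup>2)
      = complex_of_real ((ip_norm H x)\<^sup>2 - (cmod (ip H x y))\<^sup>2 / (ip_norm H y)\<^sup>2)"
    using assms c by (simp only: ip_self[of "x \<ominus> c \<odot>\<^bsub>H\<^esub> y"] a_minus_carrier smult_carrier)
  then show ?thesis
    unfolding c_def[symmetric] of_real_eq_iff .
qed

lemma Cauchy_Schwarz:
  assumes "x \<in> carrier H" "y \<in> carrier H"
  shows "cmod (ip H x y) \<le> ip_norm H x * ip_norm H y"
proof (cases "y = \<zero>")
  case False
  then have "0 < (ip_norm H y)\<^sup>2"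
    using assms by simp
  moreover have "(cmod (ip H x y))\<^sup>2 / (ip_norm H y)\<^sup>2 \<le> (ip_norm H x)\<^sup>2"
    using ip_norm_minus_projection[OF assms False] by (smt (verit) zero_le_power2)
  ultimately have "(cmod (ip H x y))\<^sup>2 \<le> (ip_norm H x * ip_norm H y)\<^sup>2"
    by (simp add: pos_divide_le_eq power_mult_distrib)
  then show ?thesis
    by (rule power2_le_imp_le) (use assms in simp)
qed (use assms in simp)

lemma ip_norm_triangle:
  assumes "x \<in> carrier H" "y \<in> carrier H"
  shows "ip_norm H (x \<oplus> y) \<le> ip_norm H x + ip_norm H y"
proof -
  have "complex_of_real ((ip_norm H (x \<oplus> y))\<^sup>2)
      = complex_of_real ((ip_norm H x)\<^sup>2 + (ip_norm H y)\<^sup>2) + (ip H x y + cnj (ip H x y))"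
    using assms ip_commute[of x y] by (simp add: ip_simps ip_self[symmetric] del: of_real_power)
  then have "(ip_norm H (x \<oplus> y))\<^sup>2 = (ip_norm H x)\<^sup>2 + (ip_norm H y)\<^sup>2 + 2 * Re (ip H x y)"
    by (simp add: complex_eq_iff del: of_real_power)
  also have "\<dots> \<le> (ip_norm H x + ip_norm H y)\<^sup>2"
    using Cauchy_Schwarz[OF assms] complex_Re_le_cmod[of "ip H x y"]
    by (simp add: power2_sum)
  finally show ?thesis
    by (rule power2_le_imp_le) (use assms in simp)
qed

section \<open>The metric topology of an inner product space\<close>

lemma Metric_space_ip_dist: "Metric_space (carrier H) (ip_dist H)"
proof
  show "0 \<le> ip_dist H x y" for x y
    by (simp add: ip_dist_def)
  show "ip_dist H x y = ip_dist H y x" for x y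
    by (auto simp: ip_dist_def ip_norm_def ip_diff_left ip_diff_right)
  show "ip_dist H x y = 0 \<longleftrightarrow> x = y" if "x \<in> carrier H" "y \<in> carrier H" for x y
    using that eq_if_minus_eq_zero[of x y] by (auto simp: ip_dist_def a_minus_def M.r_neg)
  show "ip_dist H x z \<le> ip_dist H x y + ip_dist H y z"
    if "x \<in> carrier H" "y \<in> carrier H" "z \<in> carrier H" for x y z
  proof -
    have "x \<ominus> z = (x \<ominus> y) \<oplus> (y \<ominus> z)"
      using that by (intro ip_eqI) (simp_all add: ip_simps)
    then show ?thesis
      using that ip_norm_triangle[of "x \<ominus> y" "y \<ominus> z"] by (simp add: ip_dist_def)
  qed
qed

sublocale Metric_space "carrier H" "ip_dist H"
  by (rule Metric_space_ip_dist)

text \<open>If \<open>b\<close> is orthogonal to \<open>y\<close>, then \<open>ip H a y\<close> is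
  the inner product of \<open>a \<ominus> b\<close> with \<open>y\<close>, so Cauchy-Schwarz keeps
  \<open>b\<close> at distance at least \<open>cmod (ip H a y) / ip_norm H y\<close> from
  \<open>a\<close>. The ball of that radius about \<open>a\<close> therefore misses the
  hyperplane.\<close>

lemma closedin_ip_eq_0:
  assumes "y \<in> carrier H"
  shows "closedin (ip_topology H) {x \<in> carrier H. ip H x y = 0}"
  unfolding closedin_metric
proof (intro conjI allI impI)
  fix a assume a: "a \<in> carrier H - {x \<in> carrier H. ip H x y = 0}"
  then have "y \<noteq> \<zero>"
    by auto
  then have y: "0 < ip_norm H y"
    using assms by (simp add: order_less_le)
  have "ip H b y \<noteq> 0" if b: "b \<in> carrier H" "ip_dist H a b < cmod (ip H a y) / ip_norm H y" for b
  proof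
    assume "ip H b y = 0"
    then have "cmod (ip H a y) \<le> ip_dist H a b * ip_norm H y"
      using a b(1) assms Cauchy_Schwarz[of "a \<ominus> b" y] by (simp add: ip_dist_def ip_diff_left)
    then show False
      using b(2) y by (simp add: pos_less_divide_eq)
  qed
  then have "disjnt {x \<in> carrier H. ip H x y = 0} (mball a (cmod (ip H a y) / ip_norm H y))"
    by (auto simp: disjnt_def)
  moreover have "0 < cmod (ip H a y) / ip_norm H y"
    using a y by auto
  ultimately show "\<exists>r>0. disjnt {x \<in> carrier H. ip H x y = 0} (mball a r)"
    by blast
qed auto

section \<open>Linear subspaces and the parallelogram identity\<close>

lemma uminus_eq_smult: "x \<in> carrier H \<Longrightarrow> \<ominus> x = (- 1) \<odot>\<^bsub>H\<^esub> x"
  by (rule ip_eqI) (simp_all add: ip_neg_right ip_smult_right)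

lemma submoduleI_linear:
  assumes "S \<subseteq> carrier H" "S \<noteq> {}"
    and add: "\<And>x y. \<lbrakk>x \<in> S; y \<in> S\<rbrakk> \<Longrightarrow> x \<oplus> y \<in> S"
    and smult: "\<And>c x. \<lbrakk>c \<in> K; x \<in> S\<rbrakk> \<Longrightarrow> c \<odot>\<^bsub>H\<^esub> x \<in> S"
  shows "submodule S (scalar_field K) H"
proof (rule submoduleI)
  show neg: "\<ominus> x \<in> S" if "x \<in> S" for x
    using smult[of "- 1" x] that assms(1) uminus_eq_smult[of x] by auto
  obtain x where "x \<in> S"
    using assms(2) by blast
  then show "\<zero> \<in> S"
    using add[of x "\<ominus> x"] neg[of x] assms(1) by (auto simp: M.r_neg)
qed (use assms in auto)

lemma ip_norm_sq: "x \<in> carrier H \<Longrightarrow> (ip_norm H x)\<^sup>2 = Re (ip H x x)"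
  by (simp add: ip_norm_def ip_self_nonneg)

text \<open>The parallelogram law for \<open>x \<ominus> y\<close> and \<open>x \<ominus> z\<close>,
  whose sum is twice the vector from the midpoint of \<open>y\<close> and \<open>z\<close> to
  \<open>x\<close>. It forces two nearly closest points of a subspace to be near each other, since
  their midpoint cannot be much closer to \<open>x\<close>.\<close>

lemma parallelogram_midpoint:
  assumes "x \<in> carrier H" "y \<in> carrier H" "z \<in> carrier H"
  shows "(ip_norm H (y \<ominus> z))\<^sup>2 = 2 * (ip_norm H (x \<ominus> y))\<^sup>2 + 2 * (ip_norm H (x \<ominus> z))\<^sup>2
    - 4 * (ip_norm H (x \<ominus> complex_of_real (1/2) \<odot>\<^bsub>H\<^esub> (y \<oplus> z)))\<^sup>2"
proof -
  \<comment> \<open>The factor 1/2 is generalised to a real \<open>r\<close>, so that the scalar is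
    visibly an element of \<open>K\<close>.\<close>
  have mid: "Re (ip H (x \<ominus> complex_of_real r \<odot>\<^bsub>H\<^esub> (y \<oplus> z))
      (x \<ominus> complex_of_real r \<odot>\<^bsub>H\<^esub> (y \<oplus> z)))
    = Re (ip H x x) - r * Re (ip H x y + ip H x z + ip H y x + ip H z x)
      + r * r * Re (ip H y y + ip H y z + ip H z y + ip H z z)" for r
    using assms by (simp add: ip_simps algebra_simps)
  define v where "v = x \<ominus> complex_of_real (1/2) \<odot>\<^bsub>H\<^esub> (y \<oplus> z)"
  have "v \<in> carrier H"
    unfolding v_def using assms by (simp del: of_real_divide)
  then show ?thesis
    unfolding v_def[symmetric] using assms mid[of "1/2", folded v_def]
    by (simp add: ip_norm_sq ip_simps field_simps)
qed

end

section \<open>The projection theorem and the Riesz representation theorem\<close>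

context hilbert_space
begin

text \<open>A sequence in \<open>S\<close> minimising the distance to \<open>x\<close> is Cauchy by
  the parallelogram identity. Its limit lies in \<open>S\<close> by closedness and attains the
  minimum, and minimality forces orthogonality.\<close>

lemma orthogonal_projection:
  assumes sub: "submodule S (scalar_field K) H" and closed: "closedin (ip_topology H) S"
    and x: "x \<in> carrier H"
  obtains p where "p \<in> S" "\<And>s. s \<in> S \<Longrightarrow> ip H (x \<ominus> p) s = 0"
proof -
  note S = submoduleE[OF sub, simplified]
  have S_carrier: "s \<in> carrier H" if "s \<in> S" for s
    using that S(1) by blast
  define \<delta> where "\<delta> = (INF s\<in>S. (ip_norm H (x \<ominus> s))\<^sup>2)"
  have \<delta>_le: "\<delta> \<le> (ip_norm H (x \<ominus> s))\<^sup>2" if "s \<in> S" for s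
    unfolding \<delta>_def by (rule cINF_lower) (auto intro!: bdd_belowI2[of _ 0] simp: that)
  have \<delta>_nonneg: "0 \<le> \<delta>"
    unfolding \<delta>_def using S(2) by (intro cINF_greatest) auto
  have "\<exists>s\<in>S. (ip_norm H (x \<ominus> s))\<^sup>2 < \<delta> + 1 / real (Suc n)" for n
  proof -
    have "\<delta> < \<delta> + 1 / real (Suc n)"
      by simp
    then show ?thesis
      using cInf_lessD[of "(\<lambda>s. (ip_norm H (x \<ominus> s))\<^sup>2) ` S" "\<delta> + 1 / real (Suc n)"] S(2)
      unfolding \<delta>_def by blast
  qed
  then obtain \<sigma> where \<sigma>: "\<And>n. \<sigma> n \<in> S"
    and \<sigma>_less: "\<And>n. (ip_norm H (x \<ominus> \<sigma> n))\<^sup>2 < \<delta> + 1 / real (Suc n)"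
    by metis
  have \<sigma>_carrier [simp]: "\<sigma> n \<in> carrier H" for n
    using \<sigma> S_carrier by blast
  \<comment> \<open>The midpoint lies in \<open>S\<close>, so the subtracted term of the
    parallelogram identity is at least \<open>4 * \<delta>\<close>, which cancels the two
    contributions \<open>2 * \<delta>\<close> of the other terms.\<close>
  have gap: "(ip_dist H (\<sigma> m) (\<sigma> n))\<^sup>2 \<le> 2 / real (Suc m) + 2 / real (Suc n)" for m n
  proof -
    have "\<delta> \<le> (ip_norm H (x \<ominus> complex_of_real (1/2) \<odot>\<^bsub>H\<^esub> (\<sigma> m \<oplus> \<sigma> n)))\<^sup>2"
      by (rule \<delta>_le) (simp add: S(4,5) \<sigma> del: of_real_divide)
    then show ?thesis
      using parallelogram_midpoint[OF x \<sigma>_carrier \<sigma>_carrier, of m n] \<sigma>_less[of m] \<sigma>_less[of n]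
      by (simp add: ip_dist_def)
  qed
  have "MCauchy \<sigma>"
    unfolding MCauchy_def
  proof (intro conjI allI impI)
    fix \<epsilon> :: real assume \<epsilon>: "0 < \<epsilon>"
    \<comment> \<open>For indices from \<open>N\<close> on, \<open>gap\<close> bounds the squared
      distance by \<open>4 / real (Suc N)\<close>, hence the quarter.\<close>
    then obtain N where N: "inverse (real (Suc N)) < \<epsilon>\<^sup>2 / 4"
      using reals_Archimedean[of "\<epsilon>\<^sup>2 / 4"] by auto
    have "ip_dist H (\<sigma> m) (\<sigma> n) < \<epsilon>" if "N \<le> m" "N \<le> n" for m n
    proof -
      have "2 / real (Suc k) \<le> 2 * inverse (real (Suc N))" if "N \<le> k" for k
        using that by (simp add: field_simps)
      from this[of m] this[of n] have "(ip_dist H (\<sigma> m) (\<sigma> n))\<^sup>2 < \<epsilon>\<^sup>2"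
        using gap[of m n] N that by linarith
      then show ?thesis
        by (rule power2_less_imp_less) (use \<epsilon> in simp)
    qed
    then show "\<exists>N. \<forall>m n. N \<le> m \<longrightarrow> N \<le> n \<longrightarrow> ip_dist H (\<sigma> m) (\<sigma> n) < \<epsilon>"
      by blast
  qed auto
  then obtain p where p: "limitin mtopology \<sigma> p sequentially"
    using complete by (auto simp: mcomplete_def)
  then have p_S: "p \<in> S"
    using closed \<sigma> by (intro limitin_closedin[OF p]) auto
  then have p_carrier [simp]: "p \<in> carrier H"
    by (rule S_carrier)
  \<comment> \<open>The triangle inequality through \<open>\<sigma> n\<close> gives an upper bound
    for every \<open>n\<close>; these bounds tend to \<open>sqrt \<delta>\<close>.\<close>
  have "ip_norm H (x \<ominus> p) \<le> sqrt \<delta>"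
  proof (rule LIMSEQ_le_const)
    have "(\<lambda>n. ip_dist H (\<sigma> n) p) \<longlonglongrightarrow> 0"
      using p by (simp add: limitin_metric_dist_null)
    moreover have "(\<lambda>n. sqrt (\<delta> + 1 / real (Suc n))) \<longlonglongrightarrow> sqrt (\<delta> + 0)"
      by (intro tendsto_intros LIMSEQ_Suc[OF lim_1_over_n])
    ultimately show "(\<lambda>n. sqrt (\<delta> + 1 / real (Suc n)) + ip_dist H (\<sigma> n) p) \<longlonglongrightarrow> sqrt \<delta>"
      using tendsto_add by fastforce
    have "ip_norm H (x \<ominus> p) \<le> sqrt (\<delta> + 1 / real (Suc n)) + ip_dist H (\<sigma> n) p" for n
      using triangle[OF x \<sigma>_carrier p_carrier, of n] real_le_rsqrt[OF less_imp_le[OF \<sigma>_less[of n]]] x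
      by (simp add: ip_dist_def)
    then show "\<exists>N. \<forall>n\<ge>N. ip_norm H (x \<ominus> p) \<le> sqrt (\<delta> + 1 / real (Suc n)) + ip_dist H (\<sigma> n) p"
      by blast
  qed
  then have p_min: "(ip_norm H (x \<ominus> p))\<^sup>2 \<le> \<delta>"
    using x \<delta>_nonneg by (simp add: real_le_rsqrt sqrt_ge_absD)
  have "ip H (x \<ominus> p) s = 0" if s: "s \<in> S" for s
  proof (cases "s = \<zero>")
    case False
    have s_carrier [simp]: "s \<in> carrier H"
      using s by (rule S_carrier)
    define c where "c = ip H (x \<ominus> p) s / ip H s s"
    have c: "c \<in> K"
      unfolding c_def using x by (intro scalar_divide ip_closed) auto
    have "x \<ominus> (p \<oplus> c \<odot>\<^bsub>H\<^esub> s) = (x \<ominus> p) \<ominus> c \<odot>\<^bsub>H\<^esub> s"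
      using x c by (intro ip_eqI) (simp_all add: ip_simps)
    then have "\<delta> \<le> (ip_norm H ((x \<ominus> p) \<ominus> c \<odot>\<^bsub>H\<^esub> s))\<^sup>2"
      using \<delta>_le[of "p \<oplus> c \<odot>\<^bsub>H\<^esub> s"] c by (simp add: S(4,5) p_S s)
    then have "(cmod (ip H (x \<ominus> p) s))\<^sup>2 / (ip_norm H s)\<^sup>2 \<le> 0"
      using p_min ip_norm_minus_projection[of "x \<ominus> p" s] x False by (simp add: c_def)
    then show ?thesis
      using False by (simp add: divide_le_0_iff)
  qed (use x in simp)
  with p_S show thesis
    by (rule that)
qed

lemma Riesz_representation:
  assumes closed: "closedin (ip_topology H) {x \<in> carrier H. f x = 0}"
    and f_K: "\<And>x. x \<in> carrier H \<Longrightarrow> f x \<in> K"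
    and f_add: "\<And>x y. \<lbrakk>x \<in> carrier H; y \<in> carrier H\<rbrakk> \<Longrightarrow> f (x \<oplus> y) = f x + f y"
    and f_smult: "\<And>c x. \<lbrakk>c \<in> K; x \<in> carrier H\<rbrakk> \<Longrightarrow> f (c \<odot>\<^bsub>H\<^esub> x) = c * f x"
  obtains y where "y \<in> carrier H" "\<And>x. x \<in> carrier H \<Longrightarrow> f x = ip H x y"
proof (cases "\<forall>x\<in>carrier H. f x = 0")
  case True
  then show thesis
    using that[of \<zero>] by simp
next
  case False
  then obtain x where x: "x \<in> carrier H" "f x \<noteq> 0"
    by blast
  let ?N = "{x \<in> carrier H. f x = 0}"
  have f_diff: "f (x \<ominus> y) = f x - f y" if "x \<in> carrier H" "y \<in> carrier H" for x y
    using that by (simp add: a_minus_def uminus_eq_smult f_add f_smult)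
  have "f \<zero> = 0"
    using f_add[of \<zero> \<zero>] by simp
  then have "submodule ?N (scalar_field K) H"
    by (intro submoduleI_linear; force simp: f_add f_smult)
  then obtain p where p: "p \<in> ?N" "\<And>s. s \<in> ?N \<Longrightarrow> ip H (x \<ominus> p) s = 0"
    using orthogonal_projection[OF _ closed x(1)] by blast
  define n where "n = x \<ominus> p"
  have n [simp]: "n \<in> carrier H" and fn: "f n \<noteq> 0" and n_orth: "\<And>s. s \<in> ?N \<Longrightarrow> ip H n s = 0"
    using x p by (auto simp: n_def f_diff)
  have "n \<noteq> \<zero>"
    using fn \<open>f \<zero> = 0\<close> by auto
  then have nn: "ip H n n \<noteq> 0"
    by simp
  \<comment> \<open>The value is conjugated because the inner product is conjugate linear in its
    second argument.\<close>
  define c where "c = cnj (f n) / ip H n n"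
  have c: "c \<in> K"
    unfolding c_def by (intro scalar_divide ip_closed scalar_cnj f_K) auto
  show thesis
  proof (rule that)
    show "c \<odot>\<^bsub>H\<^esub> n \<in> carrier H"
      using c by simp
    fix z assume z: "z \<in> carrier H"
    have r: "f z / f n \<in> K"
      using z by (intro scalar_divide f_K) auto
    then have "z \<ominus> (f z / f n) \<odot>\<^bsub>H\<^esub> n \<in> ?N"
      using z fn by (simp add: f_diff f_smult)
    then have "ip H (z \<ominus> (f z / f n) \<odot>\<^bsub>H\<^esub> n) n = 0"
      using n_orth ip_commute[of n "z \<ominus> (f z / f n) \<odot>\<^bsub>H\<^esub> n"] by simp
    then have "ip H z n = (f z / f n) * ip H n n"
      using z r by (simp add: ip_simps)
    moreover have "cnj (ip H n n) = ip H n n"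
      using ip_commute[of n n] by simp
    ultimately show "f z = ip H z (c \<odot>\<^bsub>H\<^esub> n)"
      using z c fn nn by (simp add: ip_smult_right c_def)
  qed
qed

end

section \<open>The adjoint of a continuous linear map\<close>

locale hilbert_space_map = G: hilbert_space K G + H: hilbert_space K H
  for K :: "complex set" and G :: "('a, 'm) ip_space_scheme" and H :: "('b, 'n) ip_space_scheme" +
  fixes T :: "'a \<Rightarrow> 'b"
  assumes continuous_linear: "continuous_linear_map K G H T"
begin

abbreviation adj :: "'b \<Rightarrow> 'a"
  where "adj \<equiv> adjoint_map G H T"

lemma
  shows T_closed [simp]: "x \<in> carrier G \<Longrightarrow> T x \<in> carrier H"
    and T_add: "\<lbrakk>x \<in> carrier G; y \<in> carrier G\<rbrakk> \<Longrightarrow> T (x \<oplus>\<^bsub>G\<^esub> y) = T x \<oplus>\<^bsub>H\<^esub> T y"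
    and T_smult: "\<lbrakk>c \<in> K; x \<in> carrier G\<rbrakk> \<Longrightarrow> T (c \<odot>\<^bsub>G\<^esub> x) = c \<odot>\<^bsub>H\<^esub> T x"
    and T_continuous: "continuous_map (ip_topology G) (ip_topology H) T"
  using continuous_linear by (auto simp: continuous_linear_map_def hom_def)

text \<open>Riesz representation of the functional sending \<open>z\<close> to
  \<open>ip H (T z) y\<close>: its kernel is the preimage under the continuous \<open>T\<close> of
  the closed hyperplane orthogonal to \<open>y\<close>. This justifies the definite description in
  \<open>adjoint_map\<close>.\<close>

lemma adj_unique_exists:
  assumes y: "y \<in> carrier H"
  shows "\<exists>!x. x \<in> carrier G \<and> (\<forall>z\<in>carrier G. ip H (T z) y = ip G z x)"
proof -
  have "{x \<in> carrier G. ip H (T x) y = 0} = {x \<in> carrier G. T x \<in> {x \<in> carrier H. ip H x y = 0}}"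
    by auto
  then have "closedin (ip_topology G) {x \<in> carrier G. ip H (T x) y = 0}"
    using closedin_continuous_map_preimage[OF T_continuous H.closedin_ip_eq_0[OF y]] by simp
  then obtain x where "x \<in> carrier G" "\<And>z. z \<in> carrier G \<Longrightarrow> ip H (T z) y = ip G z x"
    using y by (elim G.Riesz_representation) (simp_all add: T_add T_smult H.ip_simps H.ip_closed)
  then show ?thesis
    using G.ip_eqI by (intro ex1I[of _ x]) auto
qed

lemma
  assumes "y \<in> carrier H"
  shows adj_closed [simp]: "adj y \<in> carrier G"
    and ip_adj_right: "z \<in> carrier G \<Longrightarrow> ip G z (adj y) = ip H (T z) y"
  using theI'[OF adj_unique_exists[OF assms]] by (auto simp: adjoint_map_def)

lemma ip_adj_left: "\<lbrakk>y \<in> carrier H; z \<in> carrier G\<rbrakk> \<Longrightarrow> ip G (adj y) z = ip H y (T z)"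
  using G.ip_commute[of z "adj y"] H.ip_commute[of "T z" y] by (simp add: ip_adj_right)

lemma adj_add: "\<lbrakk>x \<in> carrier H; y \<in> carrier H\<rbrakk> \<Longrightarrow> adj (x \<oplus>\<^bsub>H\<^esub> y) = adj x \<oplus>\<^bsub>G\<^esub> adj y"
  by (rule G.ip_eqI) (simp_all add: ip_adj_right G.ip_add_right H.ip_add_right)

lemma adj_smult: "\<lbrakk>c \<in> K; x \<in> carrier H\<rbrakk> \<Longrightarrow> adj (c \<odot>\<^bsub>H\<^esub> x) = c \<odot>\<^bsub>G\<^esub> adj x"
  by (rule G.ip_eqI) (simp_all add: ip_adj_right G.ip_smult_right H.ip_smult_right)

lemma submodule_image: "submodule (T ` carrier G) (scalar_field K) H"
  by (rule H.submoduleI_linear) (auto simp flip: T_add T_smult)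

lemma submodule_image_adj: "submodule (adj ` carrier H) (scalar_field K) G"
  by (rule G.submoduleI_linear) (auto simp flip: adj_add adj_smult)

end

section \<open>A single degree: the Laplacian at the middle of two maps composing to zero\<close>

locale hilbert_sequence =
  F: hilbert_space K F + G: hilbert_space K G + H: hilbert_space K H +
  S: hilbert_space_map K F G S + T: hilbert_space_map K G H T
  for K :: "complex set" and F :: "('a, 'l) ip_space_scheme" and G :: "('b, 'm) ip_space_scheme"
    and H :: "('c, 'n) ip_space_scheme" and S T +
  assumes composite: "x \<in> carrier F \<Longrightarrow> T (S x) = \<zero>\<^bsub>H\<^esub>"
begin

text \<open>With \<open>S\<close> as \<open>d (i - 1)\<close> and \<open>T\<close> as
  \<open>d i\<close> this is \<open>laplace U d i\<close>.\<close>

definition lap :: "'b \<Rightarrow> 'b"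
  where "lap x = T.adj (T x) \<oplus>\<^bsub>G\<^esub> S (S.adj x)"

lemma lap_closed [simp]: "x \<in> carrier G \<Longrightarrow> lap x \<in> carrier G"
  by (simp add: lap_def)

text \<open>Moving the adjoints across exhibits the Hermitian form of the Laplacian. Symmetry,
  linearity and the kernel of \<open>lap\<close> are all read off from it.\<close>

lemma ip_lap_right:
  "\<lbrakk>x \<in> carrier G; y \<in> carrier G\<rbrakk>
    \<Longrightarrow> ip G x (lap y) = ip H (T x) (T y) + ip F (S.adj x) (S.adj y)"
  by (simp add: lap_def G.ip_add_right T.ip_adj_right S.ip_adj_left)

lemma ip_lap_left:
  "\<lbrakk>x \<in> carrier G; y \<in> carrier G\<rbrakk>
    \<Longrightarrow> ip G (lap x) y = ip H (T x) (T y) + ip F (S.adj x) (S.adj y)"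
  by (simp add: lap_def G.ip_add_left T.ip_adj_left S.ip_adj_right)

lemma lap_selfadjoint: "\<lbrakk>x \<in> carrier G; y \<in> carrier G\<rbrakk> \<Longrightarrow> ip G (lap x) y = ip G x (lap y)"
  by (simp add: ip_lap_left ip_lap_right)

lemma lap_add: "\<lbrakk>x \<in> carrier G; y \<in> carrier G\<rbrakk> \<Longrightarrow> lap (x \<oplus>\<^bsub>G\<^esub> y) = lap x \<oplus>\<^bsub>G\<^esub> lap y"
  by (rule G.ip_eqI)
    (simp_all add: ip_lap_right G.ip_add_right T.T_add S.adj_add H.ip_add_right F.ip_add_right)

lemma lap_smult: "\<lbrakk>c \<in> K; x \<in> carrier G\<rbrakk> \<Longrightarrow> lap (c \<odot>\<^bsub>G\<^esub> x) = c \<odot>\<^bsub>G\<^esub> lap x"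
  by (rule G.ip_eqI)
    (simp_all add: ip_lap_right G.ip_smult_right T.T_smult S.adj_smult H.ip_smult_right
      F.ip_smult_right distrib_left)

text \<open>Pairing \<open>lap x\<close> with \<open>x\<close> gives the sum of the squared norms of
  \<open>T x\<close> and \<open>S.adj x\<close>, which vanishes only if both do.\<close>

lemma lap_eq_zero_iff:
  assumes x: "x \<in> carrier G"
  shows "lap x = \<zero>\<^bsub>G\<^esub> \<longleftrightarrow> T x = \<zero>\<^bsub>H\<^esub> \<and> S.adj x = \<zero>\<^bsub>F\<^esub>"
proof
  assume "lap x = \<zero>\<^bsub>G\<^esub>"
  then have "Re (ip H (T x) (T x)) + Re (ip F (S.adj x) (S.adj x)) = 0"
    using ip_lap_right[OF x x] x by (simp flip: plus_complex.sel(1))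
  then show "T x = \<zero>\<^bsub>H\<^esub> \<and> S.adj x = \<zero>\<^bsub>F\<^esub>"
    using x H.ip_pos[of "T x"] F.ip_pos[of "S.adj x"] H.ip_self_nonneg[of "T x"]
      F.ip_self_nonneg[of "S.adj x"] by force
next
  assume "T x = \<zero>\<^bsub>H\<^esub> \<and> S.adj x = \<zero>\<^bsub>F\<^esub>"
  then show "lap x = \<zero>\<^bsub>G\<^esub>"
    using x by (intro G.ip_eqI) (simp_all add: ip_lap_right)
qed

lemma kernel_lap:
  "a_kernel G G lap = {x \<in> carrier G. T x = \<zero>\<^bsub>H\<^esub> \<and> S.adj x = \<zero>\<^bsub>F\<^esub>}"
  by (auto simp: a_kernel_def' lap_eq_zero_iff)

lemma submodule_image_lap: "submodule (lap ` carrier G) (scalar_field K) G"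
  by (rule G.submoduleI_linear) (auto simp flip: lap_add lap_smult)

lemma submodule_kernel_lap: "submodule (a_kernel G G lap) (scalar_field K) G"
proof (rule G.submoduleI_linear)
  have "lap \<zero>\<^bsub>G\<^esub> = \<zero>\<^bsub>G\<^esub>"
    by (rule G.ip_eqI) (simp_all flip: lap_selfadjoint)
  then show "a_kernel G G lap \<noteq> {}"
    by (auto simp: a_kernel_def')
qed (auto simp: a_kernel_def' lap_add lap_smult)

lemma hodge_decomposition:
  assumes closed: "closedin (ip_topology G) (lap ` carrier G)"
  shows "orthogonal_direct_sum K G (S ` carrier F) (T.adj ` carrier H) (a_kernel G G lap)"
  unfolding orthogonal_direct_sum_def
proof (intro conjI)
  show "submodule (S ` carrier F) (scalar_field K) G"
    by (rule S.submodule_image)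
  show "submodule (T.adj ` carrier H) (scalar_field K) G"
    by (rule T.submodule_image_adj)
  show "submodule (a_kernel G G lap) (scalar_field K) G"
    by (rule submodule_kernel_lap)
  \<comment> \<open>Moving \<open>T.adj\<close> across produces the composite of \<open>T\<close>
    and \<open>S\<close>, which is zero.\<close>
  show "orthogonal_subsets G (S ` carrier F) (T.adj ` carrier H)"
    by (auto simp: orthogonal_subsets_def T.ip_adj_right composite)
  \<comment> \<open>Here and in the next claim the map is moved onto the kernel element, which both
    \<open>S.adj\<close> and \<open>T\<close> annihilate.\<close>
  show "orthogonal_subsets G (S ` carrier F) (a_kernel G G lap)"
    by (auto simp: orthogonal_subsets_def kernel_lap simp flip: S.ip_adj_right)
  show "orthogonal_subsets G (T.adj ` carrier H) (a_kernel G G lap)"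
    by (auto simp: orthogonal_subsets_def kernel_lap T.ip_adj_left)
  show "carrier G = S ` carrier F <+>\<^bsub>G\<^esub> T.adj ` carrier H <+>\<^bsub>G\<^esub> a_kernel G G lap"
  proof
    show "carrier G \<subseteq> S ` carrier F <+>\<^bsub>G\<^esub> T.adj ` carrier H <+>\<^bsub>G\<^esub> a_kernel G G lap"
    proof
      fix x assume x: "x \<in> carrier G"
      obtain p where "p \<in> lap ` carrier G"
        and orth: "\<And>s. s \<in> lap ` carrier G \<Longrightarrow> ip G (x \<ominus>\<^bsub>G\<^esub> p) s = 0"
        using G.orthogonal_projection[OF submodule_image_lap closed x] by blast
      then obtain u where u: "u \<in> carrier G" "p = lap u"
        by blast
      define k where "k = x \<ominus>\<^bsub>G\<^esub> p"
      have k: "k \<in> carrier G"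
        using x u by (simp add: k_def)
      then have "ip G k (lap (lap k)) = 0"
        using orth by (auto simp: k_def)
      then have "ip G (lap k) (lap k) = 0"
        using k by (simp add: lap_selfadjoint)
      then have "k \<in> a_kernel G G lap"
        using k by (simp add: a_kernel_def')
      \<comment> \<open>The two summands of \<open>lap u\<close> are swapped to match the order of
        the decomposition.\<close>
      moreover have "x = S (S.adj u) \<oplus>\<^bsub>G\<^esub> T.adj (T u) \<oplus>\<^bsub>G\<^esub> k"
        using G.add_minus_cancel[of x p] x u by (simp add: k_def lap_def G.M.a_comm)
      ultimately show "x \<in> S ` carrier F <+>\<^bsub>G\<^esub> T.adj ` carrier H <+>\<^bsub>G\<^esub> a_kernel G G lap"
        using u(1) unfolding set_add_def' by fastforce
    qed
    show "S ` carrier F <+>\<^bsub>G\<^esub> T.adj ` carrier H <+>\<^bsub>G\<^esub> a_kernel G G lap \<subseteq> carrier G"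
      by (auto simp: set_add_def' a_kernel_def')
  qed
qed

end

section \<open>From a single degree to the whole complex\<close>

lemma (in hilbert_complex) hilbert_sequence_at:
  "hilbert_sequence K (U (i - 1)) (U i) (U (i + 1)) (d (i - 1)) (d i)"
proof -
  have map: "hilbert_space_map K (U j) (U (j + 1)) (d j)" for j
    by (intro hilbert_space_map.intro hilbert_space_map_axioms.intro hilbert differential)
  \<comment> \<open>This is \<open>differential_square\<close> in degree \<open>i - 1\<close>; the
    indices \<open>i - 1 + 1\<close> and \<open>i - 1 + 2\<close> become \<open>i\<close> and
    \<open>i + 1\<close>.\<close>
  have "d i (d (i - 1) x) = \<zero>\<^bsub>U (i + 1)\<^esub>" if "x \<in> carrier (U (i - 1))" for x
    using differential_square[OF that] by (simp add: add.commute)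
  then show ?thesis
    using map[of i] map[of "i - 1"]
    by (intro hilbert_sequence.intro hilbert_sequence_axioms.intro hilbert) auto
qed

theorem lemma1:
  fixes K :: "complex set" and U :: "int \<Rightarrow> 'a ip_space" and d :: "int \<Rightarrow> 'a \<Rightarrow> 'a"
  assumes "hilbert_complex K U d"
    and "\<And>i. closedin (ip_topology (U i)) (laplace U d i ` carrier (U i))"
  shows "hodge_theory_holds K U d"
  unfolding hodge_theory_holds_def
proof
  fix i
  interpret hilbert_sequence K "U (i - 1)" "U i" "U (i + 1)" "d (i - 1)" "d i"
    by (rule hilbert_complex.hilbert_sequence_at[OF assms(1)])
  \<comment> \<open>The target space of \<open>d (i - 1)\<close> in
    \<open>diff_adjoint U d (i - 1)\<close> is \<open>U (i - 1 + 1)\<close>, which simplifies to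
    \<open>U i\<close>.\<close>
  have "lap = laplace U d i"
    by (simp add: fun_eq_iff lap_def laplace_def diff_adjoint_def)
  then show "orthogonal_direct_sum K (U i) (d (i - 1) ` carrier (U (i - 1)))
      (diff_adjoint U d i ` carrier (U (i + 1))) (a_kernel (U i) (U i) (laplace U d i))"
    using hodge_decomposition assms(2)[of i] by (simp add: diff_adjoint_def)
qed

end
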